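(* For any graph $G$ and any field $\mathbb{K}$ there exist a finite set $V'$ and abstract simplicial complexes $\Delta'\subset\Delta$ on $V'$ such that for all $k\in\mathbb{Z}_{>0}$ \[ \varphi_G(k)=\mathcal{H}_{I_{\Delta/\Delta'}}(k). \]
   Context: A graph is a tuple $(V,E,\mathrm{head},\mathrm{tail})$ with finite vertex set $V$, finite edge set $E$ and maps $\mathrm{head},\mathrm{tail}:E\to V$ (loops and multiple edges allowed). A $k$-flow of $G$ is a map $f:E\to\{-k+1,\ldots,k-1\}$ such that for every vertex $v$, $\sum_{e:\mathrm{head}(e)=v}f_e-\sum_{e:\mathrm{tail}(e)=v}f_e=0$; it is nowhere zero if $f_e\neq0$ for all $e$. $\varphi_G(k)$ denotes the number of nowhere-zero $k$-flows of $G$ (the integral flow polynomial). For an abstract simplicial complex $\Delta$ on a finite set $V'$, identify $V'$ with the variables of $\mathbb{K}[x]=\mathbb{K}[x_v:v\in V']$ (standard grading). The Stanley–Reisner ideal is $I_\Delta=\langle x^u:\mathrm{supp}(u)\notin\Delta\rangle$, $\mathbb{K}[\Delta]=\mathbb{K}[x]/I_\Delta$, and for a subcomplex $\Delta'\subset\Delta$ the relative Stanley–Reisner ideal $I_{\Delta/\Delta'}$ is the ideal of $\mathbb{K}[\Delta]$ generated by the monomials $x^u$ with $\mathrm{supp}(u)\notin\Delta'$. Its Hilbert function $\mathcal{H}_{I_{\Delta/\Delta'}}(k)$ is the number of monomials $x^u$ of degree $k$ with $\mathrm{supp}(u)\in\Delta\setminus\Delta'$. *)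

theory Defs
  imports
    "Graph_Theory.Digraph"
    "HOL-Algebra.QuotRing"
    "HOL-Algebra.Embedded_Algebras"
    "HOL-Library.Poly_Mapping"
    "HOL-Library.FuncSet"
begin

section \<open>Integral flows\<close>

definition k_flows :: "('a, 'b) pre_digraph \<Rightarrow> nat \<Rightarrow> ('b \<Rightarrow> int) set" where
  "k_flows G k =
    {f \<in> arcs G \<rightarrow>\<^sub>E {- int k + 1..int k - 1}.
       \<forall>v \<in> verts G.
         (\<Sum>e | e \<in> arcs G \<and> head G e = v. f e) - (\<Sum>e | e \<in> arcs G \<and> tail G e = v. f e) = 0}"

definition nowhere_zero_k_flows :: "('a, 'b) pre_digraph \<Rightarrow> nat \<Rightarrow> ('b \<Rightarrow> int) set" where
  "nowhere_zero_k_flows G k = {f \<in> k_flows G k. \<forall>e \<in> arcs G. f e \<noteq> 0}"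

definition integral_flow_polynomial :: "('a, 'b) pre_digraph \<Rightarrow> nat \<Rightarrow> nat" where
  "integral_flow_polynomial G k = card (nowhere_zero_k_flows G k)"


section \<open>Stanley--Reisner ideals\<close>

text \<open>
  The empty family is allowed, and points of the ground set need not be vertices of the complex.
\<close>

definition abstract_simplicial_complex :: "'v set \<Rightarrow> 'v set set \<Rightarrow> bool" where
  "abstract_simplicial_complex V \<Delta> \<longleftrightarrow> \<Delta> \<subseteq> Pow V \<and> (\<forall>S \<in> \<Delta>. \<forall>T. T \<subseteq> S \<longrightarrow> T \<in> \<Delta>)"

text \<open>
  An exponent vector \<open>u\<close> is a finitely supported function into the naturals, its support is
  \<open>keys u\<close>, and \<open>x\<^sup>u\<close> is \<open>Poly_Mapping.single u 1\<close>.
\<close>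

definition total_degree :: "('v \<Rightarrow>\<^sub>0 nat) \<Rightarrow> nat" where
  "total_degree u = (\<Sum>v \<in> Poly_Mapping.keys u. Poly_Mapping.lookup u v)"

definition mpoly_ring :: "'v set \<Rightarrow> (('v \<Rightarrow>\<^sub>0 nat) \<Rightarrow>\<^sub>0 'k::field) ring" where
  "mpoly_ring V =
    \<lparr>carrier = {p. \<forall>u \<in> Poly_Mapping.keys p. Poly_Mapping.keys u \<subseteq> V},
     mult = (*), one = 1, zero = 0, add = (+)\<rparr>"

definition SR_ideal :: "'v set \<Rightarrow> 'v set set \<Rightarrow> (('v \<Rightarrow>\<^sub>0 nat) \<Rightarrow>\<^sub>0 'k::field) set" where
  "SR_ideal V \<Delta> =
    Idl\<^bsub>mpoly_ring V\<^esub>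
      {Poly_Mapping.single u 1 |u. Poly_Mapping.keys u \<subseteq> V \<and> Poly_Mapping.keys u \<notin> \<Delta>}"

definition SR_ring :: "'v set \<Rightarrow> 'v set set \<Rightarrow> (('v \<Rightarrow>\<^sub>0 nat) \<Rightarrow>\<^sub>0 'k::field) set ring" where
  "SR_ring V \<Delta> = mpoly_ring V Quot SR_ideal V \<Delta>"

definition SR_proj ::
  "'v set \<Rightarrow> 'v set set \<Rightarrow> (('v \<Rightarrow>\<^sub>0 nat) \<Rightarrow>\<^sub>0 'k::field) \<Rightarrow> (('v \<Rightarrow>\<^sub>0 nat) \<Rightarrow>\<^sub>0 'k) set" where
  "SR_proj V \<Delta> p = SR_ideal V \<Delta> +>\<^bsub>mpoly_ring V\<^esub> p"

definition relative_SR_ideal ::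
  "'v set \<Rightarrow> 'v set set \<Rightarrow> 'v set set \<Rightarrow> (('v \<Rightarrow>\<^sub>0 nat) \<Rightarrow>\<^sub>0 'k::field) set set" where
  "relative_SR_ideal V \<Delta> \<Delta>' =
    Idl\<^bsub>SR_ring V \<Delta>\<^esub>
      {SR_proj V \<Delta> (Poly_Mapping.single u 1) |u.
         Poly_Mapping.keys u \<subseteq> V \<and> Poly_Mapping.keys u \<notin> \<Delta>'}"

text \<open>
  The scalars are the image of the ground field in the Stanley--Reisner ring; \<open>ring.dim\<close> below
  is the vector space dimension over them.
\<close>

definition SR_scalars :: "'v set \<Rightarrow> 'v set set \<Rightarrow> (('v \<Rightarrow>\<^sub>0 nat) \<Rightarrow>\<^sub>0 'k::field) set set" where
  "SR_scalars V \<Delta> = {SR_proj V \<Delta> (Poly_Mapping.single 0 c) |c. True}"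

definition SR_graded_piece ::
  "'v set \<Rightarrow> 'v set set \<Rightarrow> nat \<Rightarrow> (('v \<Rightarrow>\<^sub>0 nat) \<Rightarrow>\<^sub>0 'k::field) set set" where
  "SR_graded_piece V \<Delta> k =
    SR_proj V \<Delta> ` {p \<in> carrier (mpoly_ring V). \<forall>u \<in> Poly_Mapping.keys p. total_degree u = k}"

text \<open>
  For a homogeneous ideal \<open>J\<close> of the Stanley--Reisner ring this is the vector space dimension,
  over the ground field, of the part of \<open>J\<close> of degree \<open>k\<close>.  For relative Stanley--Reisner
  ideals it is the number of monomials of degree \<open>k\<close> with support in the difference of the
  two complexes; see \<open>hilbert_function_relative_SR_ideal\<close> below.
\<close>

definition hilbert_function ::
  "'v set \<Rightarrow> 'v set set \<Rightarrow> (('v \<Rightarrow>\<^sub>0 nat) \<Rightarrow>\<^sub>0 'k::field) set set \<Rightarrow> nat \<Rightarrow> nat" where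
  "hilbert_function V \<Delta> J k =
    ring.dim (SR_ring V \<Delta>) (SR_scalars V \<Delta>) (J \<inter> SR_graded_piece V \<Delta> k)"


subsection \<open>The Hilbert function counts monomials\<close>

lemma poly_mapping_sum_single:
  "(\<Sum>u \<in> Poly_Mapping.keys p. Poly_Mapping.single u (Poly_Mapping.lookup p u)) = p"
  by (rule poly_mapping_eqI)
     (auto simp: lookup_sum lookup_single when_def in_keys_iff sum.delta)

lemma keys_add_exp:
  fixes u w :: "'v \<Rightarrow>\<^sub>0 nat"
  shows "Poly_Mapping.keys (u + w) = Poly_Mapping.keys u \<union> Poly_Mapping.keys w"
  by (auto simp: in_keys_iff lookup_add)

lemma keys_mult_exp:
  fixes p q :: "('v \<Rightarrow>\<^sub>0 nat) \<Rightarrow>\<^sub>0 'k::field"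
  assumes "w \<in> Poly_Mapping.keys (p * q)"
  obtains a b where "a \<in> Poly_Mapping.keys p" "b \<in> Poly_Mapping.keys q" "w = a + b"
  using assms keys_mult[of p q] by blast

lemma mpoly_ring_simps [simp]:
  "carrier (mpoly_ring V) = {p. \<forall>u \<in> Poly_Mapping.keys p. Poly_Mapping.keys u \<subseteq> V}"
  "mult (mpoly_ring V) = (*)" "one (mpoly_ring V) = 1" "zero (mpoly_ring V) = 0"
  "add (mpoly_ring V) = (+)"
  by (simp_all add: mpoly_ring_def)

lemma cring_mpoly_ring: "cring (mpoly_ring V)"
proof (rule cringI)
  show "abelian_group (mpoly_ring V)"
  proof (rule abelian_groupI)
    fix x assume x: "x \<in> carrier (mpoly_ring V)"
    show "\<exists>y \<in> carrier (mpoly_ring V). y \<oplus>\<^bsub>mpoly_ring V\<^esub> x = \<zero>\<^bsub>mpoly_ring V\<^esub>"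
      by (rule bexI[of _ "- x"]) (use x in \<open>auto simp: in_keys_iff\<close>)
  qed (use keys_add in \<open>fastforce simp: add_ac\<close>)+
  show "Group.comm_monoid (mpoly_ring V)"
    by (rule comm_monoidI)
       (auto simp: mult_ac keys_add_exp subset_iff elim!: keys_mult_exp)
qed (simp add: distrib_right)

lemma SR_ideal_eq:
  assumes "abstract_simplicial_complex V \<Delta>"
  shows "SR_ideal V \<Delta> =
    {p :: ('v \<Rightarrow>\<^sub>0 nat) \<Rightarrow>\<^sub>0 'k::field.
       \<forall>u \<in> Poly_Mapping.keys p. Poly_Mapping.keys u \<subseteq> V \<and> Poly_Mapping.keys u \<notin> \<Delta>}"
    (is "_ = ?M")
    and "ideal (SR_ideal V \<Delta> :: (('v \<Rightarrow>\<^sub>0 nat) \<Rightarrow>\<^sub>0 'k) set) (mpoly_ring V)"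
proof -
  let ?P = "mpoly_ring V :: (('v \<Rightarrow>\<^sub>0 nat) \<Rightarrow>\<^sub>0 'k) ring"
  let ?G = "{Poly_Mapping.single u (1::'k) |u. Poly_Mapping.keys u \<subseteq> V \<and> Poly_Mapping.keys u \<notin> \<Delta>}"
  interpret P: cring ?P by (rule cring_mpoly_ring)
  have down: "T \<in> \<Delta>" if "S \<in> \<Delta>" "T \<subseteq> S" for S T
    using assms that unfolding abstract_simplicial_complex_def by blast
  have sub: "subgroup ?M (add_monoid ?P)"
  proof (rule P.add.subgroupI)
    fix a assume a: "a \<in> ?M"
    have "\<ominus>\<^bsub>?P\<^esub> a = - a"
      by (rule P.minus_equality) (use a in \<open>auto simp: in_keys_iff\<close>)
    thus "\<ominus>\<^bsub>?P\<^esub> a \<in> ?M"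
      using a by (auto simp: in_keys_iff)
  next
    fix a b assume "a \<in> ?M" "b \<in> ?M"
    thus "a \<oplus>\<^bsub>?P\<^esub> b \<in> ?M"
      using keys_add[of a b] by fastforce
  qed (auto intro: exI[of _ 0])
  have idM: "ideal ?M ?P"
  proof (rule idealI[OF P.ring_axioms sub])
    fix a x assume a: "a \<in> ?M" and x: "x \<in> carrier ?P"
    have "Poly_Mapping.keys w \<subseteq> V \<and> Poly_Mapping.keys w \<notin> \<Delta>"
      if "w \<in> Poly_Mapping.keys (x * a)" for w
      using that a x by (elim keys_mult_exp) (auto simp: keys_add_exp dest: down)
    thus "x \<otimes>\<^bsub>?P\<^esub> a \<in> ?M" "a \<otimes>\<^bsub>?P\<^esub> x \<in> ?M"
      by (simp_all add: mult.commute)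
  qed
  have G: "?G \<subseteq> carrier ?P" by auto
  show id: "ideal (SR_ideal V \<Delta>) ?P"
    unfolding SR_ideal_def by (rule P.genideal_ideal[OF G])
  show "SR_ideal V \<Delta> = ?M"
  proof
    show "SR_ideal V \<Delta> \<subseteq> ?M"
      unfolding SR_ideal_def by (rule P.genideal_minimal[OF idM]) auto
    show "?M \<subseteq> SR_ideal V \<Delta>"
    proof
      fix p assume p: "p \<in> ?M"
      interpret I: ideal "SR_ideal V \<Delta>" ?P by (rule id)
      have mono: "Poly_Mapping.single u c \<in> SR_ideal V \<Delta>"
        if "Poly_Mapping.keys u \<subseteq> V" "Poly_Mapping.keys u \<notin> \<Delta>" for u and c :: 'k
      proof -
        have "Poly_Mapping.single u (1 :: 'k) \<in> SR_ideal V \<Delta>"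
          unfolding SR_ideal_def by (rule subsetD[OF P.genideal_self[OF G]]) (use that in auto)
        from I.I_l_closed[OF this, of "Poly_Mapping.single 0 c"] show ?thesis
          by (auto simp: mult_single)
      qed
      have "(\<Sum>u \<in> A. Poly_Mapping.single u (Poly_Mapping.lookup p u)) \<in> SR_ideal V \<Delta>"
        if "finite A" "A \<subseteq> Poly_Mapping.keys p" for A
        using that
      proof (induction A)
        case empty
        show ?case using I.zero_closed by simp
      next
        case (insert u A)
        thus ?case using I.a_closed[OF mono] p by simp
      qed
      from this[of "Poly_Mapping.keys p"] show "p \<in> SR_ideal V \<Delta>"
        by (simp add: poly_mapping_sum_single)
    qed
  qed
qed

context
  fixes V :: "'v set" and \<Delta> :: "'v set set" and K :: "'k::field itself"
  assumes asc: "abstract_simplicial_complex V \<Delta>"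
begin

private abbreviation (input) PR :: "(('v \<Rightarrow>\<^sub>0 nat) \<Rightarrow>\<^sub>0 'k) ring" where "PR \<equiv> mpoly_ring V"
private abbreviation (input) SRI :: "(('v \<Rightarrow>\<^sub>0 nat) \<Rightarrow>\<^sub>0 'k) set" where "SRI \<equiv> SR_ideal V \<Delta>"
private abbreviation (input) SRR :: "(('v \<Rightarrow>\<^sub>0 nat) \<Rightarrow>\<^sub>0 'k) set ring" where "SRR \<equiv> SR_ring V \<Delta>"

lemma SR_proj_hom: "ring_hom_ring PR SRR (SR_proj V \<Delta>)"
  unfolding SR_ring_def SR_proj_def [abs_def]
  by (rule ideal.rcos_ring_hom_ring[OF SR_ideal_eq(2)[OF asc]])

lemma cring_SR_ring: "cring SRR"
  unfolding SR_ring_def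
  by (rule ideal.quotient_is_cring[OF SR_ideal_eq(2)[OF asc] cring_mpoly_ring])

lemma carrier_SR_ring: "carrier SRR = SR_proj V \<Delta> ` carrier PR"
  unfolding SR_ring_def FactRing_def SR_proj_def A_RCOSETS_def' by auto

lemma SR_proj_eq_iff:
  assumes "p \<in> carrier PR" "q \<in> carrier PR"
  shows "(SR_proj V \<Delta> p :: (('v \<Rightarrow>\<^sub>0 nat) \<Rightarrow>\<^sub>0 'k) set) = SR_proj V \<Delta> q \<longleftrightarrow>
    (\<forall>u. Poly_Mapping.keys u \<in> \<Delta> \<longrightarrow> Poly_Mapping.lookup p u = Poly_Mapping.lookup q u)"
proof -
  interpret P: cring PR by (rule cring_mpoly_ring)
  interpret I: ideal SRI PR by (rule SR_ideal_eq(2)[OF asc])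
  have neg: "\<ominus>\<^bsub>PR\<^esub> q = - q"
    by (rule P.minus_equality) (use assms in \<open>auto simp: in_keys_iff\<close>)
  have "SR_proj V \<Delta> p = (SR_proj V \<Delta> q :: (('v \<Rightarrow>\<^sub>0 nat) \<Rightarrow>\<^sub>0 'k) set) \<longleftrightarrow> p - q \<in> SRI"
    unfolding SR_proj_def
    using P.quotient_eq_iff_same_a_r_cos[OF SR_ideal_eq(2)[OF asc] assms] neg
    by (simp add: a_minus_def)
  also have "\<dots> \<longleftrightarrow> (\<forall>u. Poly_Mapping.keys u \<in> \<Delta> \<longrightarrow> Poly_Mapping.lookup p u = Poly_Mapping.lookup q u)"
  proof -
    have "Poly_Mapping.keys u \<subseteq> V" if "Poly_Mapping.lookup p u \<noteq> Poly_Mapping.lookup q u" for u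
    proof -
      have "u \<in> Poly_Mapping.keys p \<or> u \<in> Poly_Mapping.keys q"
        using that by (auto simp: in_keys_iff)
      thus ?thesis using assms by auto
    qed
    thus ?thesis
      unfolding SR_ideal_eq(1)[OF asc] mem_Collect_eq Ball_def in_keys_iff lookup_minus
        right_minus_eq by blast
  qed
  finally show ?thesis .
qed

lemma relative_SR_ideal_eq:
  assumes "abstract_simplicial_complex V \<Delta>'" "\<Delta>' \<subseteq> \<Delta>"
  shows "(relative_SR_ideal V \<Delta> \<Delta>' :: (('v \<Rightarrow>\<^sub>0 nat) \<Rightarrow>\<^sub>0 'k) set set) =
    SR_proj V \<Delta> ` SR_ideal V \<Delta>'"
proof
  let ?h = "SR_proj V \<Delta> :: (('v \<Rightarrow>\<^sub>0 nat) \<Rightarrow>\<^sub>0 'k) \<Rightarrow> _"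
  let ?G = "{Poly_Mapping.single u (1::'k) |u. Poly_Mapping.keys u \<subseteq> V \<and> Poly_Mapping.keys u \<notin> \<Delta>'}"
  interpret P: cring PR by (rule cring_mpoly_ring)
  interpret h: ring_hom_ring PR SRR ?h by (rule SR_proj_hom)
  have rel: "relative_SR_ideal V \<Delta> \<Delta>' = Idl\<^bsub>SRR\<^esub> (?h ` ?G)"
    unfolding relative_SR_ideal_def by (rule arg_cong[where f = "genideal SRR"]) blast
  have G: "?G \<subseteq> carrier PR" by auto
  have hG: "?h ` ?G \<subseteq> carrier SRR" using image_mono[OF G] unfolding carrier_SR_ring .
  have idl: "ideal (relative_SR_ideal V \<Delta> \<Delta>') SRR"
    unfolding rel by (rule h.S.genideal_ideal[OF hG])
  have "ideal {p \<in> carrier PR. ?h p \<in> relative_SR_ideal V \<Delta> \<Delta>'} PR"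
    by (rule h.ideal_vimage[OF idl])
  moreover have "?G \<subseteq> {p \<in> carrier PR. ?h p \<in> relative_SR_ideal V \<Delta> \<Delta>'}"
    using G h.S.genideal_self[OF hG] unfolding rel by blast
  ultimately have "SR_ideal V \<Delta>' \<subseteq> {p \<in> carrier PR. ?h p \<in> relative_SR_ideal V \<Delta> \<Delta>'}"
    unfolding SR_ideal_def by (rule P.genideal_minimal)
  thus "?h ` SR_ideal V \<Delta>' \<subseteq> relative_SR_ideal V \<Delta> \<Delta>'" by blast
  have "ideal (?h ` SR_ideal V \<Delta>') SRR"
  proof -
    have "SRI \<subseteq> SR_ideal V \<Delta>'"
      using assms asc by (auto simp: SR_ideal_eq(1))
    thus ?thesis
      unfolding SR_proj_def SR_ring_def
      by (intro P.ring_ideal_imp_quot_ideal SR_ideal_eq(2) asc assms(1))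
  qed
  moreover have "?h ` ?G \<subseteq> ?h ` SR_ideal V \<Delta>'"
    unfolding SR_ideal_def using P.genideal_self[OF G] by blast
  ultimately show "relative_SR_ideal V \<Delta> \<Delta>' \<subseteq> ?h ` SR_ideal V \<Delta>'"
    unfolding rel by (rule h.S.genideal_minimal)
qed

lemma graded_part_eq:
  assumes "abstract_simplicial_complex V \<Delta>'" "\<Delta>' \<subseteq> \<Delta>"
  shows "(relative_SR_ideal V \<Delta> \<Delta>' :: (('v \<Rightarrow>\<^sub>0 nat) \<Rightarrow>\<^sub>0 'k) set set) \<inter> SR_graded_piece V \<Delta> k =
    SR_proj V \<Delta> ` {p. Poly_Mapping.keys p \<subseteq>
      {u. Poly_Mapping.keys u \<in> \<Delta> - \<Delta>' \<and> total_degree u = k}}"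
    (is "?L = SR_proj V \<Delta> ` {p. _ \<subseteq> ?B}")
proof
  have V: "S \<subseteq> V" if "S \<in> \<Delta>" for S
    using asc that unfolding abstract_simplicial_complex_def by blast
  show "SR_proj V \<Delta> ` {p :: (('v \<Rightarrow>\<^sub>0 nat) \<Rightarrow>\<^sub>0 'k). Poly_Mapping.keys p \<subseteq> ?B} \<subseteq> ?L"
    unfolding relative_SR_ideal_eq[OF assms] SR_graded_piece_def SR_ideal_eq(1)[OF assms(1)]
    by (auto dest: V intro!: imageI)
  show "?L \<subseteq> SR_proj V \<Delta> ` {p. Poly_Mapping.keys p \<subseteq> ?B}"
  proof
    fix X :: "(('v \<Rightarrow>\<^sub>0 nat) \<Rightarrow>\<^sub>0 'k) set"
    assume "X \<in> ?L"
    then obtain p q where p: "p \<in> SR_ideal V \<Delta>'" "X = SR_proj V \<Delta> p"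
      and q: "q \<in> carrier PR" "\<forall>u \<in> Poly_Mapping.keys q. total_degree u = k" "X = SR_proj V \<Delta> q"
      unfolding relative_SR_ideal_eq[OF assms] SR_graded_piece_def by blast
    have p': "p \<in> carrier PR" using p(1) by (simp add: SR_ideal_eq(1)[OF assms(1)])
    have pq: "Poly_Mapping.lookup p u = Poly_Mapping.lookup q u" if "Poly_Mapping.keys u \<in> \<Delta>" for u
      using SR_proj_eq_iff[OF p' q(1)] p(2) q(3) that by blast
    define r where "r = (\<Sum>u \<in> Poly_Mapping.keys q \<inter> {u. Poly_Mapping.keys u \<in> \<Delta>}.
      Poly_Mapping.single u (Poly_Mapping.lookup q u))"
    have r: "Poly_Mapping.lookup r u =
        (if Poly_Mapping.keys u \<in> \<Delta> then Poly_Mapping.lookup q u else 0)" for u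
      unfolding r_def by (auto simp: lookup_sum lookup_single when_def in_keys_iff sum.delta)
    have kr: "Poly_Mapping.keys r \<subseteq> ?B"
    proof
      fix u assume "u \<in> Poly_Mapping.keys r"
      hence u: "Poly_Mapping.keys u \<in> \<Delta>" "u \<in> Poly_Mapping.keys q"
        by (auto simp: in_keys_iff r split: if_splits)
      hence "u \<in> Poly_Mapping.keys p" using pq by (simp add: in_keys_iff)
      thus "u \<in> ?B" using u q(2) p(1) by (auto simp: SR_ideal_eq(1)[OF assms(1)])
    qed
    hence "r \<in> carrier PR" by (auto dest!: V)
    hence "X = SR_proj V \<Delta> r"
      unfolding q(3) by (subst SR_proj_eq_iff[OF q(1)]) (auto simp: r)
    thus "X \<in> SR_proj V \<Delta> ` {p. Poly_Mapping.keys p \<subseteq> ?B}" using kr by blast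
  qed
qed

lemma subfield_SR_scalars:
  assumes "\<Delta> \<noteq> {}"
  shows "subfield (SR_scalars V \<Delta>) SRR"
proof -
  let ?h = "SR_proj V \<Delta> :: (('v \<Rightarrow>\<^sub>0 nat) \<Rightarrow>\<^sub>0 'k) \<Rightarrow> _"
  let ?C = "Poly_Mapping.single 0 ` (UNIV :: 'k set) :: (('v \<Rightarrow>\<^sub>0 nat) \<Rightarrow>\<^sub>0 'k) set"
  interpret P: cring PR by (rule cring_mpoly_ring)
  interpret h: ring_hom_ring PR SRR ?h by (rule SR_proj_hom)
  have empty: "{} \<in> \<Delta>"
    using assms asc unfolding abstract_simplicial_complex_def by blast
  have sr: "subring ?C PR"
  proof (rule P.subringI)
    fix a assume "a \<in> ?C"
    then obtain c where c: "a = Poly_Mapping.single 0 c" by blast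
    have "\<ominus>\<^bsub>PR\<^esub> a = Poly_Mapping.single 0 (- c)"
      by (rule P.minus_equality) (auto simp: c simp flip: single_add)
    thus "\<ominus>\<^bsub>PR\<^esub> a \<in> ?C" by blast
  qed (auto simp: mult_single split: if_splits simp flip: single_add single_one)
  have sf: "subfield ?C PR"
  proof (rule P.subfieldI)
    show "subcring ?C PR"
      by (rule P.subcringI[OF sr]) (simp add: mult.commute)
    have nz: "Poly_Mapping.single 0 c * a \<noteq> (1 :: ('v \<Rightarrow>\<^sub>0 nat) \<Rightarrow>\<^sub>0 'k)" if "c = 0" for c a
      using that by simp
    have inv: "Poly_Mapping.single 0 c * Poly_Mapping.single 0 (inverse c) =
        (1 :: ('v \<Rightarrow>\<^sub>0 nat) \<Rightarrow>\<^sub>0 'k)" if "c \<noteq> 0" for c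
      using that by (simp add: mult_single)
    have nonzero: "x \<noteq> 0" if "y * x = 1" for x y :: "('v \<Rightarrow>\<^sub>0 nat) \<Rightarrow>\<^sub>0 'k"
      using that by auto
    show "Units (PR\<lparr>carrier := ?C\<rparr>) = ?C - {\<zero>\<^bsub>PR\<^esub>}"
    proof (intro equalityI subsetI)
      fix x assume "x \<in> Units (PR\<lparr>carrier := ?C\<rparr>)"
      thus "x \<in> ?C - {\<zero>\<^bsub>PR\<^esub>}"
        unfolding Units_def using nonzero by auto
    next
      fix x assume x: "x \<in> ?C - {\<zero>\<^bsub>PR\<^esub>}"
      then obtain c where c: "x = Poly_Mapping.single 0 c" "c \<noteq> 0" by fastforce
      show "x \<in> Units (PR\<lparr>carrier := ?C\<rparr>)"
        unfolding Units_def
        using x inv[OF c(2)] by (auto simp: c(1) mult.commute intro!: exI[of _ "inverse c"])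
    qed
  qed
  have "\<one>\<^bsub>SRR\<^esub> \<noteq> \<zero>\<^bsub>SRR\<^esub>"
  proof -
    have "?h 1 \<noteq> ?h 0"
      by (subst SR_proj_eq_iff) (use empty in \<open>auto intro!: exI[of _ 0]\<close>)
    thus ?thesis using h.hom_one h.hom_zero by simp
  qed
  hence "subfield (?h ` ?C) SRR"
    by (rule h.img_is_subfield(2)[OF sf])
  moreover have "?h ` ?C = SR_scalars V \<Delta>" unfolding SR_scalars_def by blast
  ultimately show ?thesis by simp
qed

lemma combine_SR_proj:
  assumes "distinct us" "\<forall>u \<in> set us. Poly_Mapping.keys u \<subseteq> V"
  shows "ring.combine SRR (map (\<lambda>u. SR_proj V \<Delta> (Poly_Mapping.single 0 (f u))) us)
      (map (\<lambda>u. SR_proj V \<Delta> (Poly_Mapping.single u 1)) us) =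
    (SR_proj V \<Delta> (\<Sum>u \<in> set us. Poly_Mapping.single u (f u)) :: (('v \<Rightarrow>\<^sub>0 nat) \<Rightarrow>\<^sub>0 'k) set)"
  using assms
proof (induction us)
  case Nil
  interpret h: ring_hom_ring PR SRR "SR_proj V \<Delta>" by (rule SR_proj_hom)
  show ?case using h.hom_zero by simp
next
  case (Cons u us)
  interpret h: ring_hom_ring PR SRR "SR_proj V \<Delta>" by (rule SR_proj_hom)
  let ?s = "\<Sum>u \<in> set us. Poly_Mapping.single u (f u)"
  have 1: "Poly_Mapping.single u (f u) \<in> carrier PR" using Cons.prems by auto
  have "Poly_Mapping.keys ?s \<subseteq> set us"
    using keys_sum[of "\<lambda>u. Poly_Mapping.single u (f u)" "set us"]
    by (auto split: if_splits)
  hence 2: "?s \<in> carrier PR" using Cons.prems by auto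
  have 3: "SR_proj V \<Delta> (Poly_Mapping.single 0 (f u)) \<otimes>\<^bsub>SRR\<^esub> SR_proj V \<Delta> (Poly_Mapping.single u 1) =
      SR_proj V \<Delta> (Poly_Mapping.single u (f u))"
    using Cons.prems h.hom_mult[of "Poly_Mapping.single 0 (f u)" "Poly_Mapping.single u 1"]
    by (simp add: mult_single)
  show ?case
    using Cons h.hom_add[OF 1 2] by (simp add: 3)
qed

lemma dim_SR:
  assumes B: "finite B" "\<And>u. u \<in> B \<Longrightarrow> Poly_Mapping.keys u \<in> \<Delta>" and "\<Delta> \<noteq> {}"
  shows "ring.dim SRR (SR_scalars V \<Delta>) (SR_proj V \<Delta> ` {p. Poly_Mapping.keys p \<subseteq> B}) = card B"
proof -
  let ?h = "SR_proj V \<Delta> :: (('v \<Rightarrow>\<^sub>0 nat) \<Rightarrow>\<^sub>0 'k) \<Rightarrow> _"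
  let ?K = "SR_scalars V \<Delta> :: (('v \<Rightarrow>\<^sub>0 nat) \<Rightarrow>\<^sub>0 'k) set set"
  let ?c = "\<lambda>f u. ?h (Poly_Mapping.single 0 (f u))"
  let ?b = "\<lambda>u. ?h (Poly_Mapping.single u 1)"
  interpret h: ring_hom_ring PR SRR ?h by (rule SR_proj_hom)
  note K = subfield_SR_scalars[OF \<open>\<Delta> \<noteq> {}\<close>]
  have BV: "Poly_Mapping.keys u \<subseteq> V" if "u \<in> B" for u
    using B(2)[OF that] asc unfolding abstract_simplicial_complex_def by blast
  obtain us where us: "distinct us" "set us = B"
    using finite_distinct_list[OF B(1)] by blast
  have carr: "set (map ?b us) \<subseteq> carrier SRR"
    using us(2) BV by auto
  have comb: "h.S.combine (map (?c f) us) (map ?b us) = ?h (\<Sum>u \<in> B. Poly_Mapping.single u (f u))"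
    for f
    using combine_SR_proj[OF us(1)] us(2) BV by auto
  have inB: "(\<Sum>u \<in> B. Poly_Mapping.single u (f u)) \<in> {p. Poly_Mapping.keys p \<subseteq> B}" for f :: "_ \<Rightarrow> 'k"
    using keys_sum[of "\<lambda>u. Poly_Mapping.single u (f u)" B] by (auto split: if_splits)
  have coeffs: "\<exists>f. Ks = map (?c f) us" if "set Ks \<subseteq> ?K" "length Ks = length us" for Ks
  proof -
    have "\<exists>cs. Ks = map (\<lambda>c. ?h (Poly_Mapping.single 0 c)) cs"
      using that(1) unfolding SR_scalars_def ex_map_conv by blast
    then obtain cs where cs: "Ks = map (\<lambda>c. ?h (Poly_Mapping.single 0 c)) cs" by blast
    hence "cs = map (\<lambda>u. the (map_of (zip us cs) u)) us"
      using that(2) us(1) by (intro nth_equalityI) (simp_all add: map_of_zip_nth)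
    hence "Ks = map (?c (\<lambda>u. the (map_of (zip us cs) u))) us"
      unfolding cs
      by (drule_tac arg_cong[where f = "map (\<lambda>c. ?h (Poly_Mapping.single 0 c))"]) (simp add: comp_def)
    thus ?thesis by (rule exI[where P = "\<lambda>f. Ks = map (?c f) us"])
  qed
  have span: "h.S.Span ?K (map ?b us) = ?h ` {p. Poly_Mapping.keys p \<subseteq> B}"
  proof (intro equalityI subsetI)
    fix x assume "x \<in> h.S.Span ?K (map ?b us)"
    then obtain Ks where Ks: "x = h.S.combine Ks (map ?b us)" "length Ks = length us" "set Ks \<subseteq> ?K"
      unfolding h.S.Span_eq_combine_set_length_version[OF K carr] by auto
    then obtain f where "Ks = map (?c f) us" using coeffs by blast
    thus "x \<in> ?h ` {p. Poly_Mapping.keys p \<subseteq> B}"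
      using Ks(1) comb[of f] inB[of f] by simp
  next
    fix x assume "x \<in> ?h ` {p. Poly_Mapping.keys p \<subseteq> B}"
    then obtain p where p: "x = ?h p" "Poly_Mapping.keys p \<subseteq> B" by blast
    have "(\<Sum>u \<in> B. Poly_Mapping.single u (Poly_Mapping.lookup p u)) = p"
      using p(2) B(1)
      by (intro poly_mapping_eqI) (auto simp: lookup_sum lookup_single when_def sum.delta in_keys_iff)
    hence "x = h.S.combine (map (?c (Poly_Mapping.lookup p)) us) (map ?b us)"
      by (simp add: comb p(1))
    moreover have "set (map (?c (Poly_Mapping.lookup p)) us) \<subseteq> ?K"
      unfolding SR_scalars_def by auto
    ultimately show "x \<in> h.S.Span ?K (map ?b us)"
      unfolding h.S.Span_eq_combine_set_length_version[OF K carr]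
      by (intro CollectI exI[of _ "map (?c (Poly_Mapping.lookup p)) us"]) simp
  qed
  have indep: "h.S.independent ?K (map ?b us)"
  proof (rule ccontr)
    assume dep: "h.S.dependent ?K (map ?b us)"
    hence ne: "us \<noteq> []" by auto
    from h.S.dependent_imp_non_trivial_combine[OF K carr dep]
    obtain Ks where Ks: "length Ks = length us" "h.S.combine Ks (map ?b us) = \<zero>\<^bsub>SRR\<^esub>"
      "set Ks \<subseteq> ?K" "set Ks \<noteq> {\<zero>\<^bsub>SRR\<^esub>}" by (metis length_map)
    then obtain f where f: "Ks = map (?c f) us" using coeffs by blast
    have "?h (\<Sum>u \<in> B. Poly_Mapping.single u (f u)) = ?h 0"
      using Ks(2) comb[of f] h.hom_zero by (simp add: f)
    hence "Poly_Mapping.lookup (\<Sum>u \<in> B. Poly_Mapping.single u (f u)) w = 0" if "w \<in> B" for w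
      using SR_proj_eq_iff[of "\<Sum>u \<in> B. Poly_Mapping.single u (f u)" 0] inB[of f] BV B(2)[OF that]
      by auto
    hence "f w = 0" if "w \<in> B" for w
      using that B(1) by (simp add: lookup_sum lookup_single when_def sum.delta)
    hence "set Ks \<subseteq> {\<zero>\<^bsub>SRR\<^esub>}"
      using us(2) h.hom_zero by (auto simp: f)
    thus False using Ks(1,4) ne by (cases Ks) auto
  qed
  have "h.S.dimension (length (map ?b us)) ?K (?h ` {p. Poly_Mapping.keys p \<subseteq> B})"
    using h.S.dimension_independent[OF indep] unfolding span .
  from h.S.dimI[OF K this] show ?thesis
    using distinct_card[OF us(1)] us(2) by (simp add: over_def)
qed

lemma dim_SR_void:
  assumes "\<Delta> = {}"
  shows "ring.dim SRR (SR_scalars V \<Delta>) (SR_proj V \<Delta> ` {0}) = 0"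
proof -
  let ?h = "SR_proj V \<Delta> :: (('v \<Rightarrow>\<^sub>0 nat) \<Rightarrow>\<^sub>0 'k) \<Rightarrow> _"
  interpret h: ring_hom_ring PR SRR ?h by (rule SR_proj_hom)
  have zero: "?h p = \<zero>\<^bsub>SRR\<^esub>" if "p \<in> carrier PR" for p
    using SR_proj_eq_iff[OF that, of 0] h.hom_zero assms by simp
  have carr: "carrier SRR \<subseteq> {\<zero>\<^bsub>SRR\<^esub>}"
    unfolding carrier_SR_ring using zero by blast
  have K: "SR_scalars V \<Delta> = {\<zero>\<^bsub>SRR\<^esub>}"
    unfolding SR_scalars_def using zero by auto
  have "n = 0" if "h.S.dimension n {\<zero>\<^bsub>SRR\<^esub>} E" for n E
  proof -
    have "n = 0 \<and> E = {\<zero>\<^bsub>SRR\<^esub>}"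
      using that by (induction n "{\<zero>\<^bsub>SRR\<^esub>}" E rule: h.S.dimension.induct) (use carr in auto)
    thus ?thesis ..
  qed
  moreover have "?h ` {0} = {\<zero>\<^bsub>SRR\<^esub>}" using zero by simp
  ultimately show ?thesis
    unfolding h.S.dim_def K by (intro the_equality) auto
qed

theorem hilbert_function_relative_SR_ideal:
  assumes "finite V" "abstract_simplicial_complex V \<Delta>'" "\<Delta>' \<subseteq> \<Delta>"
  shows "hilbert_function V \<Delta> (relative_SR_ideal V \<Delta> \<Delta>' :: (('v \<Rightarrow>\<^sub>0 nat) \<Rightarrow>\<^sub>0 'k) set set) k =
    card {u. Poly_Mapping.keys u \<in> \<Delta> - \<Delta>' \<and> total_degree u = k}"
proof -
  let ?B = "{u :: 'v \<Rightarrow>\<^sub>0 nat. Poly_Mapping.keys u \<in> \<Delta> - \<Delta>' \<and> total_degree u = k}"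
  have V: "S \<subseteq> V" if "S \<in> \<Delta>" for S
    using asc that unfolding abstract_simplicial_complex_def by blast
  have fin: "finite ?B"
  proof (rule finite_imageD)
    have "Poly_Mapping.lookup u v \<le> total_degree u" for u :: "'v \<Rightarrow>\<^sub>0 nat" and v
      by (cases "v \<in> Poly_Mapping.keys u") (auto simp: total_degree_def in_keys_iff intro: member_le_sum)
    hence "Poly_Mapping.lookup ` ?B \<subseteq>
        {f. \<forall>v. (v \<in> V \<longrightarrow> f v \<in> {..k}) \<and> (v \<notin> V \<longrightarrow> f v = 0)}"
      using V by (fastforce simp: in_keys_iff)
    thus "finite (Poly_Mapping.lookup ` ?B)"
      by (rule finite_subset) (intro finite_set_of_finite_funs assms(1) finite_atMost)
    show "inj_on Poly_Mapping.lookup ?B"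
      by (rule inj_onI, rule poly_mapping_eqI) simp
  qed
  show ?thesis
  proof (cases "\<Delta> = {}")
    case True
    hence "{p :: ('v \<Rightarrow>\<^sub>0 nat) \<Rightarrow>\<^sub>0 'k. Poly_Mapping.keys p \<subseteq> ?B} = {0}" by auto
    moreover have "card ?B = 0" using True by simp
    ultimately show ?thesis
      unfolding hilbert_function_def graded_part_eq[OF assms(2,3)]
      by (simp only: dim_SR_void[OF True])
  next
    case False
    thus ?thesis
      unfolding hilbert_function_def graded_part_eq[OF assms(2,3)]
      by (intro dim_SR fin) auto
  qed
qed

end

end

theory Submission
  imports Defs "HOL-Library.Transitive_Closure_Table"
begin

text \<open>
  A flow with values in \<open>{-k..k}\<close> is a sum of \<open>k\<close> flows with values in \<open>{-1, 0, 1}\<close>.  Order the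
  latter and split off repeatedly the smallest one that leaves a flow bounded by \<open>k - 1\<close>.  Which
  ones qualify depends only on where the flow is zero, positive, negative or equal to \<open>\<plusminus>k\<close>, and so
  only on the set of summands of any such decomposition.  Hence being a greedy decomposition is a
  condition on the support of the exponent vector, and it passes to subsets: this is the pulling
  triangulation of the polytope of flows with values in \<open>[-1, 1]\<close>, cut by the coordinate
  hyperplanes.  The flows that vanish somewhere or attain \<open>\<plusminus>k\<close> form a subcomplex.
\<close>

section \<open>Rounding a flow divided by an integer\<close>

text \<open>Net inflow as a single sum over arcs: linear in \<open>f\<close>, with loops cancelling,
  and easy to sum over vertex sets.\<close>

definition excess :: "('a, 'b) pre_digraph \<Rightarrow> ('b \<Rightarrow> int) \<Rightarrow> 'a \<Rightarrow> int" where
  "excess G f x = (\<Sum>e \<in> arcs G. f e * (of_bool (head G e = x) - of_bool (tail G e = x)))"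

text \<open>For positive \<open>k\<close>, \<open>g\<close> is the floor or the ceiling of
  \<open>f / k\<close> on each arc, with no choice where \<open>k\<close> divides
  \<open>f\<close>.\<close>

definition rounding :: "'b set \<Rightarrow> ('b \<Rightarrow> int) \<Rightarrow> int \<Rightarrow> ('b \<Rightarrow> int) \<Rightarrow> bool" where
  "rounding E f k g \<longleftrightarrow> (\<forall>e \<in> E. \<bar>f e - k * g e\<bar> < k)"

text \<open>One more unit can go from \<open>x\<close> to \<open>y\<close>, forward along an arc or
  by cancelling on a reverse one, without violating the rounding bound there.\<close>

definition residual ::
  "('a, 'b) pre_digraph \<Rightarrow> ('b \<Rightarrow> int) \<Rightarrow> int \<Rightarrow> ('b \<Rightarrow> int) \<Rightarrow> 'a \<Rightarrow> 'a \<Rightarrow> bool" where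
  "residual G f k g x y \<longleftrightarrow> (\<exists>e \<in> arcs G.
     tail G e = x \<and> head G e = y \<and> \<bar>f e - k * (g e + 1)\<bar> < k \<or>
     head G e = x \<and> tail G e = y \<and> \<bar>f e - k * (g e - 1)\<bar> < k)"

context fin_digraph
begin

section \<open>Excess and cuts\<close>

lemma excess_eq:
  "excess G f x =
    (\<Sum>e | e \<in> arcs G \<and> head G e = x. f e) - (\<Sum>e | e \<in> arcs G \<and> tail G e = x. f e)"
proof -
  have "(\<Sum>e | e \<in> arcs G \<and> P e. f e) = (\<Sum>e \<in> arcs G. f e * of_bool (P e))" for P
    by (rule sum.mono_neutral_cong_left) auto
  thus ?thesis
    by (simp add: excess_def sum_subtractf right_diff_distrib)
qed

lemma k_flows_iff:
  "f \<in> k_flows G k \<longleftrightarrow>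
    f \<in> extensional (arcs G) \<and> (\<forall>e \<in> arcs G. \<bar>f e\<bar> < int k) \<and> (\<forall>x \<in> verts G. excess G f x = 0)"
  unfolding k_flows_def excess_eq by (auto simp: PiE_iff abs_less_iff)

lemma excess_cong: "(\<And>e. e \<in> arcs G \<Longrightarrow> f e = g e) \<Longrightarrow> excess G f x = excess G g x"
  unfolding excess_def by (rule sum.cong) auto

lemma excess_diff: "excess G (\<lambda>e. f e - g e) x = excess G f x - excess G g x"
  by (simp add: excess_def left_diff_distrib sum_subtractf)

lemma excess_update:
  assumes "e \<in> arcs G"
  shows "excess G (g(e := g e + d)) x =
    excess G g x + d * (of_bool (head G e = x) - of_bool (tail G e = x))"
proof -
  have "excess G (g(e := g e + d)) x - excess G g x =
      (\<Sum>a \<in> arcs G. if a = e then d * (of_bool (head G e = x) - of_bool (tail G e = x)) else 0)"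
    unfolding excess_def sum_subtractf[symmetric] by (rule sum.cong) (auto simp: algebra_simps)
  thus ?thesis using assms by simp
qed

text \<open>Arcs with both ends in \<open>X\<close> or both outside cancel, so only the cut around
  \<open>X\<close> counts.\<close>

lemma sum_excess:
  assumes "finite X"
  shows "(\<Sum>x \<in> X. excess G f x) =
    (\<Sum>e \<in> arcs G. f e * (of_bool (head G e \<in> X) - of_bool (tail G e \<in> X)))"
proof -
  have "(\<Sum>x \<in> X. of_bool (y = x)) = (of_bool (y \<in> X) :: int)" for y
    using assms by (simp add: of_bool_def)
  thus ?thesis
    unfolding excess_def
    by (subst sum.swap) (simp add: sum_distrib_left[symmetric] sum_subtractf)
qed

section \<open>Augmenting paths and integral rounding\<close>

lemma augmenting_path:
  assumes "rtrancl_path (residual G f k g) x xs t" "distinct (x # xs)" "rounding (arcs G) f k g"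
  shows "\<exists>h. rounding (arcs G) f k h \<and>
    (\<forall>z. excess G h z = excess G g z - of_bool (z = x) + of_bool (z = t)) \<and>
    (\<forall>e \<in> arcs G. head G e \<notin> set (x # xs) \<or> tail G e \<notin> set (x # xs) \<longrightarrow> h e = g e)"
  using assms
proof induction
  case (base x)
  thus ?case by (intro exI[of _ g]) simp
next
  case (step x y ys t)
  then obtain h where h: "rounding (arcs G) f k h"
    "\<And>z. excess G h z = excess G g z - of_bool (z = y) + of_bool (z = t)"
    "\<And>e. e \<in> arcs G \<Longrightarrow> head G e \<notin> set (y # ys) \<or> tail G e \<notin> set (y # ys) \<Longrightarrow> h e = g e"
    by auto
  from step.hyps(1) obtain e d where e: "e \<in> arcs G" "\<bar>f e - k * (g e + d)\<bar> < k"
    "d = 1 \<and> tail G e = x \<and> head G e = y \<or> d = - 1 \<and> head G e = x \<and> tail G e = y"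
    unfolding residual_def by (metis diff_conv_add_uminus)
  have x: "x \<noteq> y" "x \<notin> set ys" using step.prems(1) by auto
  \<comment> \<open>The first arc meets \<open>x\<close>, which distinctness keeps off the rest of
    the path; the third conjunct is carried through the induction for this.\<close>
  have he: "h e = g e" using h(3)[OF e(1)] e(3) x by auto
  let ?h = "h(e := h e + d)"
  have "rounding (arcs G) f k ?h"
    using h(1) e(2) he unfolding rounding_def by simp
  moreover have "excess G ?h z = excess G g z - of_bool (z = x) + of_bool (z = t)" for z
    unfolding excess_update[OF e(1)] h(2) using e(3) x by (auto simp: of_bool_def)
  moreover have "?h a = g a"
    if "a \<in> arcs G" "head G a \<notin> set (x # y # ys) \<or> tail G a \<notin> set (x # y # ys)" for a
    using that h(3)[OF that(1)] e(3) by auto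
  ultimately show ?case by blast
qed

text \<open>Integrality of circulations: a rounding of least total imbalance conserves flow, since
  otherwise an augmenting path or a cut gives a contradiction.\<close>

lemma exists_rounding_flow:
  assumes k: "0 < k" and f: "\<And>x. x \<in> verts G \<Longrightarrow> excess G f x = 0"
  obtains g where "rounding (arcs G) f k g" "\<And>x. x \<in> verts G \<Longrightarrow> excess G g x = 0"
proof -
  define imbalance where "imbalance g = nat (\<Sum>x \<in> verts G. \<bar>excess G g x\<bar>)" for g
  have "rounding (arcs G) f k (\<lambda>e. f e div k)"
    using k by (simp add: rounding_def minus_mult_div_eq_mod)
  then obtain g where g: "rounding (arcs G) f k g"
    and min: "\<And>h. rounding (arcs G) f k h \<Longrightarrow> imbalance g \<le> imbalance h"
    using ex_has_least_nat[of "rounding (arcs G) f k" _ imbalance] by blast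
  have nonpos: "excess G g s \<le> 0" if s: "s \<in> verts G" for s
  proof (rule ccontr)
    assume pos: "\<not> excess G g s \<le> 0"
    define X where "X = {x \<in> verts G. (residual G f k g)\<^sup>*\<^sup>* s x}"
    have X: "finite X" "s \<in> X" "X \<subseteq> verts G" using s by (auto simp: X_def)
    show False
    proof (cases "\<exists>t \<in> X. excess G g t < 0")
      case True
      then obtain t where t: "t \<in> X" "excess G g t < 0" by blast
      then obtain xs where "rtrancl_path (residual G f k g) s xs t" "distinct (s # xs)"
        unfolding X_def rtranclp_eq_rtrancl_path by (auto elim: rtrancl_path_distinct)
      from augmenting_path[OF this g] obtain h where h: "rounding (arcs G) f k h"
        "\<And>z. excess G h z = excess G g z - of_bool (z = s) + of_bool (z = t)" by blast
      \<comment> \<open>Both ends of the path come one unit closer to 0, and all other vertices keep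
        their excess.\<close>
      have "(\<Sum>x \<in> verts G. \<bar>excess G h x\<bar>) < (\<Sum>x \<in> verts G. \<bar>excess G g x\<bar>)"
        by (rule sum_strict_mono_ex1)
           (use pos t s in \<open>auto simp: h(2) of_bool_def intro!: bexI[of _ s]\<close>)
      moreover have "0 \<le> (\<Sum>x \<in> verts G. \<bar>excess G h x\<bar>)" by (rule sum_nonneg) simp
      ultimately show False using min[OF h(1)] unfolding imbalance_def by linarith
    next
      case False
      \<comment> \<open>No residual step leaves \<open>X\<close>, so outgoing arcs are rounded up
        and incoming ones down. Hence \<open>k\<close> times the net inflow of \<open>g\<close> into
        \<open>X\<close> is at most that of \<open>f\<close>, which is 0.\<close>
      have cut: "k * (g e * (of_bool (head G e \<in> X) - of_bool (tail G e \<in> X)))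
          \<le> f e * (of_bool (head G e \<in> X) - of_bool (tail G e \<in> X))" if e: "e \<in> arcs G" for e
      proof -
        have step: "y \<in> X" if "residual G f k g x y" "x \<in> X" "y \<in> verts G" for x y
          using that unfolding X_def by (auto intro: rtranclp.rtrancl_into_rtrancl)
        have ge: "\<bar>f e - k * g e\<bar> < k" using g e by (simp add: rounding_def)
        have "f e \<le> k * g e" if "tail G e \<in> X" "head G e \<notin> X"
        proof (rule ccontr)
          assume "\<not> f e \<le> k * g e"
          hence "\<bar>f e - k * (g e + 1)\<bar> < k" using ge by (simp add: distrib_left)
          hence "residual G f k g (tail G e) (head G e)" using e unfolding residual_def by blast
          thus False using step that e by auto
        qed
        moreover have "k * g e \<le> f e" if "head G e \<in> X" "tail G e \<notin> X"
        proof (rule ccontr)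
          assume "\<not> k * g e \<le> f e"
          hence "\<bar>f e - k * (g e - 1)\<bar> < k" using ge by (simp add: right_diff_distrib)
          hence "residual G f k g (head G e) (tail G e)" using e unfolding residual_def by blast
          thus False using step that e by auto
        qed
        ultimately show ?thesis by (auto simp: of_bool_def)
      qed
      have "k * (\<Sum>x \<in> X. excess G g x) \<le> (\<Sum>x \<in> X. excess G f x)"
        unfolding sum_excess[OF X(1)] sum_distrib_left by (rule sum_mono) (rule cut)
      also have "\<dots> = 0" using f X(3) by (intro sum.neutral) auto
      finally have "(\<Sum>x \<in> X. excess G g x) \<le> 0"
        using k by (simp add: mult_le_0_iff)
      moreover have "excess G g s \<le> (\<Sum>x \<in> X. excess G g x)"
        by (rule member_le_sum) (use X False in \<open>auto simp: not_less\<close>)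
      ultimately show False using pos by simp
    qed
  qed
  \<comment> \<open>Every arc has both ends in \<open>verts G\<close>, so the excesses, none of them
    positive, cancel in total.\<close>
  have "(\<Sum>x \<in> verts G. - excess G g x) = 0"
    using sum_excess[of "verts G" g] by (simp add: sum_negf)
  hence "\<forall>x \<in> verts G. - excess G g x = 0"
    using nonpos by (subst (asm) sum_nonneg_eq_0_iff) auto
  thus thesis using that g by simp
qed

lemma finite_k_flows: "finite (k_flows G k)"
  by (rule finite_subset[of _ "arcs G \<rightarrow>\<^sub>E {- int k + 1..int k - 1}"])
     (auto simp: k_flows_def intro!: finite_PiE)

end


section \<open>The triangulation\<close>

text \<open>A 2-flow takes only the values -1, 0 and 1. Its index serves as a vertex of the
  complexes, and the order of the indices is the pulling order.\<close>

locale flow_triangulation = fin_digraph G for G :: "('a, 'b) pre_digraph" +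
  fixes N :: nat and w :: "nat \<Rightarrow> 'b \<Rightarrow> int"
  assumes w_bij: "bij_betw w {..<N} (k_flows G 2)"
begin

definition val :: "(nat \<Rightarrow>\<^sub>0 nat) \<Rightarrow> 'b \<Rightarrow> int" where
  "val u e = (\<Sum>i<N. int (Poly_Mapping.lookup u i) * w i e)"

definition sign_compatible :: "nat set \<Rightarrow> bool" where
  "sign_compatible S \<longleftrightarrow> (\<forall>i \<in> S. \<forall>j \<in> S. \<forall>e \<in> arcs G. 0 \<le> w i e * w j e)"

text \<open>
  For sign compatible \<open>S\<close>, the \<open>j\<close> all of whose values occur in \<open>S\<close> are those
  that can be split off from a sum with support \<open>S\<close>.
\<close>

definition greedy :: "nat set \<Rightarrow> bool" where
  "greedy S \<longleftrightarrow>
    (\<forall>i \<in> S. \<forall>j<N. (\<forall>e \<in> arcs G. \<exists>l \<in> S. i \<le> l \<and> w j e = w l e) \<longrightarrow> i \<le> j)"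

definition triangulation :: "nat set set" where
  "triangulation = {S. S \<subseteq> {..<N} \<and> sign_compatible S \<and> greedy S}"

text \<open>On sums this says that some arc has value 0 or the extreme absolute value
  (\<open>keys_boundary_iff\<close>). In this form it passes to subsets.\<close>

definition boundary :: "nat set set" where
  "boundary = {S \<in> triangulation.
     \<exists>e \<in> arcs G. (\<forall>i \<in> S. w i e = 0) \<or> (\<forall>i \<in> S. \<bar>w i e\<bar> = 1)}"

text \<open>Shrinking \<open>S\<close> only removes indices \<open>j\<close> that satisfy the
  premise in \<open>greedy\<close>, so no new comparison with \<open>i\<close> arises.\<close>

lemma triangulation_subset: "S \<in> triangulation \<Longrightarrow> T \<subseteq> S \<Longrightarrow> T \<in> triangulation"
  unfolding triangulation_def sign_compatible_def greedy_def by (simp add: subset_iff) metis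

lemma complex_triangulation: "abstract_simplicial_complex {..<N} triangulation"
  unfolding abstract_simplicial_complex_def
proof
  show "triangulation \<subseteq> Pow {..<N}" by (auto simp: triangulation_def)
qed (use triangulation_subset in blast)

lemma complex_boundary: "abstract_simplicial_complex {..<N} boundary"
  unfolding abstract_simplicial_complex_def
proof (intro conjI ballI allI impI)
  show "boundary \<subseteq> Pow {..<N}" by (auto simp: boundary_def triangulation_def)
next
  fix S T assume S: "S \<in> boundary" and T: "T \<subseteq> S"
  hence "T \<in> triangulation" using triangulation_subset unfolding boundary_def by blast
  thus "T \<in> boundary" using S T unfolding boundary_def by blast
qed

section \<open>Sums of the numbered flows\<close>

lemma w_flow: "i < N \<Longrightarrow> w i \<in> k_flows G 2"
  using bij_betwE[OF w_bij] by simp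

lemma w_cases:
  assumes "i < N" "e \<in> arcs G"
  shows "w i e = - 1 \<or> w i e = 0 \<or> w i e = 1"
proof -
  have "\<bar>w i e\<bar> < 2" using w_flow[OF assms(1)] assms(2) by (simp add: k_flows_iff)
  thus ?thesis by linarith
qed

lemma excess_val: "x \<in> verts G \<Longrightarrow> excess G (val u) x = 0"
proof -
  assume x: "x \<in> verts G"
  have "excess G (val u) x = (\<Sum>i<N. int (Poly_Mapping.lookup u i) * excess G (w i) x)"
    unfolding excess_def val_def sum_distrib_left sum_distrib_right
    by (subst sum.swap) (simp add: mult.assoc)
  also have "\<dots> = 0" using w_flow x by (auto intro!: sum.neutral simp: k_flows_iff)
  finally show ?thesis .
qed

lemma total_degree_eq:
  "Poly_Mapping.keys u \<subseteq> {..<N} \<Longrightarrow> total_degree u = (\<Sum>i<N. Poly_Mapping.lookup u i)"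
  unfolding total_degree_def by (rule sum.mono_neutral_left) (auto simp: in_keys_iff)

lemma val_add_single:
  assumes "i < N"
  shows "val (u + Poly_Mapping.single i 1) e = val u e + w i e"
proof -
  have "val (u + Poly_Mapping.single i 1) e =
      (\<Sum>j<N. int (Poly_Mapping.lookup u j) * w j e + (if j = i then w i e else 0))"
    unfolding val_def
    by (rule sum.cong) (auto simp: lookup_add lookup_single when_def distrib_right)
  thus ?thesis using assms by (simp add: val_def sum.distrib)
qed

lemma total_degree_add_single:
  fixes u :: "nat \<Rightarrow>\<^sub>0 nat"
  assumes "Poly_Mapping.keys u \<subseteq> {..<N}" "i < N"
  shows "total_degree (u + Poly_Mapping.single i 1) = Suc (total_degree u)"
proof -
  have "Poly_Mapping.keys (u + Poly_Mapping.single i 1) \<subseteq> {..<N}"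
    using assms by (simp add: keys_add_exp)
  thus ?thesis
    using assms
    by (simp add: total_degree_eq lookup_add lookup_single when_def sum.distrib sum.delta)
qed

text \<open>\<open>val u e - k * x\<close> is a sum of \<open>k\<close> differences
  \<open>w i e - x\<close>. If one of them is 0, sign compatibility bounds the others by 1 in
  absolute value and the sum stays below \<open>k\<close>. If none is 0, they all have the same sign
  and the sum reaches \<open>k\<close>.\<close>

lemma val_near_iff:
  assumes u: "Poly_Mapping.keys u \<subseteq> {..<N}" "sign_compatible (Poly_Mapping.keys u)"
    and e: "e \<in> arcs G" and x: "x \<in> {-1, 0, 1}" and k: "k = int (total_degree u)"
  shows "\<bar>val u e - k * x\<bar> < k \<longleftrightarrow> (\<exists>j \<in> Poly_Mapping.keys u. w j e = x)"
proof -
  let ?c = "\<lambda>i. int (Poly_Mapping.lookup u i)"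
  have kk: "k = (\<Sum>i<N. ?c i)" using k total_degree_eq[OF u(1)] by simp
  have eq: "val u e - k * x = (\<Sum>i<N. ?c i * (w i e - x))"
    by (simp add: val_def kk right_diff_distrib sum_subtractf sum_distrib_right)
  have w: "w i e = -1 \<or> w i e = 0 \<or> w i e = 1" if "i \<in> Poly_Mapping.keys u" for i
    using w_cases[of i e] that u(1) e by blast
  have sgn: "0 \<le> w i e * w j e" if "i \<in> Poly_Mapping.keys u" "j \<in> Poly_Mapping.keys u" for i j
    using u(2) e that by (simp add: sign_compatible_def)
  show ?thesis
  proof
    assume "\<exists>j \<in> Poly_Mapping.keys u. w j e = x"
    then obtain j where j: "j \<in> Poly_Mapping.keys u" "w j e = x" by blast
    have le: "\<bar>?c i * (w i e - x)\<bar> \<le> ?c i" for i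
    proof (cases "i \<in> Poly_Mapping.keys u")
      case True
      have "\<bar>w i e - x\<bar> \<le> 1" using w[OF True] w[OF j(1)] sgn[OF True j(1)] j(2) by auto
      thus ?thesis by (simp add: abs_mult mult_left_le)
    qed (simp add: in_keys_iff)
    have "\<bar>val u e - k * x\<bar> \<le> (\<Sum>i<N. \<bar>?c i * (w i e - x)\<bar>)" unfolding eq by (rule sum_abs)
    also have "\<dots> < (\<Sum>i<N. ?c i)"
      by (rule sum_strict_mono_ex1)
         (use j u(1) le in \<open>auto simp: in_keys_iff subset_iff intro!: bexI[of _ j]\<close>)
    finally show "\<bar>val u e - k * x\<bar> < k" using kk by simp
  next
    assume near: "\<bar>val u e - k * x\<bar> < k"
    show "\<exists>j \<in> Poly_Mapping.keys u. w j e = x"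
    proof (rule ccontr)
      assume "\<not> ?thesis"
      hence ne: "w i e \<noteq> x" if "i \<in> Poly_Mapping.keys u" for i using that by blast
      \<comment> \<open>For \<open>x = 0\<close> the differences are the values themselves: nonzero
        and, by sign compatibility, of one sign.\<close>
      consider "x = -1" | "x = 0" "\<exists>i \<in> Poly_Mapping.keys u. w i e = 1" | "x = 0"
          "\<forall>i \<in> Poly_Mapping.keys u. w i e \<noteq> 1" | "x = 1"
        using x by blast
      hence "(\<forall>i \<in> Poly_Mapping.keys u. 1 \<le> w i e - x) \<or>
          (\<forall>i \<in> Poly_Mapping.keys u. w i e - x \<le> - 1)"
        by cases (use w ne sgn in fastforce)+
      thus False
      proof
        assume *: "\<forall>i \<in> Poly_Mapping.keys u. 1 \<le> w i e - x"
        have "?c i \<le> ?c i * (w i e - x)" for i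
          using * mult_left_mono[of 1 "w i e - x" "?c i"]
          by (cases "i \<in> Poly_Mapping.keys u") (auto simp: in_keys_iff)
        hence "(\<Sum>i<N. ?c i) \<le> (\<Sum>i<N. ?c i * (w i e - x))" by (intro sum_mono)
        hence "k \<le> val u e - k * x" unfolding kk[symmetric] eq[symmetric] .
        thus False using near by simp
      next
        assume *: "\<forall>i \<in> Poly_Mapping.keys u. w i e - x \<le> - 1"
        have "?c i * (w i e - x) \<le> - ?c i" for i
          using * mult_left_mono[of "w i e - x" "- 1" "?c i"]
          by (cases "i \<in> Poly_Mapping.keys u") (auto simp: in_keys_iff)
        hence "(\<Sum>i<N. ?c i * (w i e - x)) \<le> (\<Sum>i<N. - ?c i)" by (intro sum_mono)
        hence "val u e - k * x \<le> - k" unfolding sum_negf kk[symmetric] eq[symmetric] .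
        thus False using near by simp
      qed
    qed
  qed
qed

lemma abs_val_le:
  assumes "Poly_Mapping.keys u \<subseteq> {..<N}" "e \<in> arcs G"
  shows "\<bar>val u e\<bar> \<le> int (total_degree u)"
proof -
  have "\<bar>val u e\<bar> \<le> (\<Sum>i<N. \<bar>int (Poly_Mapping.lookup u i) * w i e\<bar>)"
    unfolding val_def by (rule sum_abs)
  also have "\<dots> \<le> (\<Sum>i<N. int (Poly_Mapping.lookup u i))"
  proof (rule sum_mono)
    fix i assume "i \<in> {..<N}"
    hence "\<bar>w i e\<bar> \<le> 1" using w_cases[of i e] assms(2) by auto
    thus "\<bar>int (Poly_Mapping.lookup u i) * w i e\<bar> \<le> int (Poly_Mapping.lookup u i)"
      by (simp add: abs_mult mult_left_le)
  qed
  finally show ?thesis by (simp add: total_degree_eq[OF assms(1)])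
qed

text \<open>The cases \<open>x = 1\<close> and \<open>x = -1\<close> of \<open>val_near_iff\<close>:
  under the bound \<open>abs_val_le\<close>, closeness to an extreme value just means having its
  sign.\<close>

lemma val_sign_iff:
  assumes "Poly_Mapping.keys u \<subseteq> {..<N}" "sign_compatible (Poly_Mapping.keys u)" "e \<in> arcs G"
  shows "0 < val u e \<longleftrightarrow> (\<exists>j \<in> Poly_Mapping.keys u. w j e = 1)"
    and "val u e < 0 \<longleftrightarrow> (\<exists>j \<in> Poly_Mapping.keys u. w j e = - 1)"
  using val_near_iff[OF assms, of 1] val_near_iff[OF assms, of "- 1"] abs_val_le[OF assms(1,3)]
  by auto

text \<open>What can be split off depends only on the support of \<open>u\<close>; this turns
  greediness of a decomposition into a condition on a set of indices.\<close>

lemma rounding_w_iff: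
  assumes "Poly_Mapping.keys u \<subseteq> {..<N}" "sign_compatible (Poly_Mapping.keys u)" "j < N"
  shows "rounding (arcs G) (val u) (int (total_degree u)) (w j) \<longleftrightarrow>
    (\<forall>e \<in> arcs G. \<exists>l \<in> Poly_Mapping.keys u. w j e = w l e)"
proof -
  have "\<bar>val u e - int (total_degree u) * w j e\<bar> < int (total_degree u) \<longleftrightarrow>
      (\<exists>l \<in> Poly_Mapping.keys u. w j e = w l e)" if "e \<in> arcs G" for e
    using val_near_iff[OF assms(1,2) that, of "w j e"] w_cases[OF assms(3) that]
    by (metis insertCI)
  thus ?thesis by (simp add: rounding_def)
qed

section \<open>Uniqueness and existence of greedy decompositions\<close>

lemma least_key_le:
  assumes u: "Poly_Mapping.keys u \<in> triangulation" and i: "i \<in> Poly_Mapping.keys u"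
    and le: "\<And>l. l \<in> Poly_Mapping.keys u \<Longrightarrow> i \<le> l"
    and j: "j < N" "rounding (arcs G) (val u) (int (total_degree u)) (w j)"
  shows "i \<le> j"
proof -
  have "\<forall>e \<in> arcs G. \<exists>l \<in> Poly_Mapping.keys u. i \<le> l \<and> w j e = w l e"
    using u j le rounding_w_iff[of u j] unfolding triangulation_def by blast
  thus ?thesis using u i j(1) unfolding triangulation_def greedy_def by blast
qed

lemma keys_rounding:
  assumes "Poly_Mapping.keys u \<in> triangulation" "i \<in> Poly_Mapping.keys u"
  shows "rounding (arcs G) (val u) (int (total_degree u)) (w i)"
  using assms rounding_w_iff[of u i] unfolding triangulation_def by blast

text \<open>The least key is the least index that rounds the sum, so \<open>u\<close> and
  \<open>u'\<close> share it. Remove one copy from both and induct on the degree.\<close>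

lemma val_inj:
  assumes "Poly_Mapping.keys u \<in> triangulation" "Poly_Mapping.keys u' \<in> triangulation"
    and "total_degree u = k" "total_degree u' = k" "\<And>e. e \<in> arcs G \<Longrightarrow> val u e = val u' e"
  shows "u = u'"
  using assms
proof (induction k arbitrary: u u')
  case 0
  have "u = 0" if "total_degree u = 0" for u :: "nat \<Rightarrow>\<^sub>0 nat"
    using that by (auto simp: total_degree_def in_keys_iff intro: poly_mapping_eqI)
  thus ?case using 0 by metis
next
  case (Suc k)
  have ne: "Poly_Mapping.keys u \<noteq> {}" "Poly_Mapping.keys u' \<noteq> {}"
    using Suc.prems(3,4) by (auto simp: total_degree_def)
  have rcong: "rounding (arcs G) (val u) c g \<longleftrightarrow> rounding (arcs G) (val u') c g" for c g
    using Suc.prems(5) by (simp add: rounding_def)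
  define i where "i = Min (Poly_Mapping.keys u)"
  define i' where "i' = Min (Poly_Mapping.keys u')"
  have i: "i \<in> Poly_Mapping.keys u" "\<And>l. l \<in> Poly_Mapping.keys u \<Longrightarrow> i \<le> l"
    and i': "i' \<in> Poly_Mapping.keys u'" "\<And>l. l \<in> Poly_Mapping.keys u' \<Longrightarrow> i' \<le> l"
    using ne by (auto simp: i_def i'_def)
  have N: "i < N" "i' < N"
    using i(1) i'(1) Suc.prems(1,2) by (auto simp: triangulation_def)
  have "i \<le> i'"
    by (rule least_key_le[OF Suc.prems(1) i N(2)])
       (use keys_rounding[OF Suc.prems(2) i'(1)] Suc.prems(3,4) rcong in simp_all)
  moreover have "i' \<le> i"
    by (rule least_key_le[OF Suc.prems(2) i' N(1)])
       (use keys_rounding[OF Suc.prems(1) i(1)] Suc.prems(3,4) rcong in simp_all)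
  ultimately have ii: "i' = i" by simp
  \<comment> \<open>Exponents subtract with truncation at 0; nothing is cut off because
    \<open>i\<close> is a key of both.\<close>
  define u1 where "u1 = u - Poly_Mapping.single i 1"
  define u1' where "u1' = u' - Poly_Mapping.single i 1"
  have u: "u = u1 + Poly_Mapping.single i 1" "u' = u1' + Poly_Mapping.single i 1"
    using i(1) i'(1) unfolding ii u1_def u1'_def
    by (auto intro!: poly_mapping_eqI
        simp: lookup_add lookup_minus lookup_single when_def in_keys_iff)
  have T: "Poly_Mapping.keys u1 \<in> triangulation" "Poly_Mapping.keys u1' \<in> triangulation"
    using triangulation_subset[OF Suc.prems(1)] triangulation_subset[OF Suc.prems(2)]
    by (simp_all add: u keys_add_exp subset_insertI)
  hence sub: "Poly_Mapping.keys u1 \<subseteq> {..<N}" "Poly_Mapping.keys u1' \<subseteq> {..<N}"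
    by (auto simp: triangulation_def)
  have "u1 = u1'"
  proof (rule Suc.IH[OF T])
    show "total_degree u1 = k" "total_degree u1' = k"
      using Suc.prems(3,4) total_degree_add_single[OF sub(1) N(1)]
        total_degree_add_single[OF sub(2) N(1)] by (simp_all add: u)
    show "val u1 e = val u1' e" if "e \<in> arcs G" for e
      using Suc.prems(5)[OF that] unfolding u val_add_single[OF N(1)] by simp
  qed
  thus ?case using u by simp
qed

text \<open>Split off the least numbered flow that rounds \<open>f\<close> at the current bound and
  decompose the rest by induction. \<open>exists_rounding_flow\<close> ensures that there is
  one.\<close>

lemma exists_greedy_decomposition:
  assumes "\<And>e. e \<in> arcs G \<Longrightarrow> \<bar>f e\<bar> \<le> int k" "\<And>x. x \<in> verts G \<Longrightarrow> excess G f x = 0"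
  shows "\<exists>u. Poly_Mapping.keys u \<in> triangulation \<and> total_degree u = k \<and>
    (\<forall>e \<in> arcs G. val u e = f e)"
  using assms
proof (induction k arbitrary: f)
  case 0
  thus ?case
    by (intro exI[of _ 0])
       (auto simp: triangulation_def sign_compatible_def greedy_def total_degree_def val_def)
next
  case (Suc k)
  define K where "K = int (Suc k)"
  define split where "split j \<longleftrightarrow> j < N \<and> rounding (arcs G) f K (w j)" for j
  have "\<exists>j. split j"
  proof -
    obtain g where g: "rounding (arcs G) f K g" "\<And>x. x \<in> verts G \<Longrightarrow> excess G g x = 0"
      using exists_rounding_flow[of K f] Suc.prems(2) by (auto simp: K_def)
    \<comment> \<open>|f e| is at most \<open>K\<close> and |f e - K * g e| is below
      \<open>K\<close>, so |K * g e| is below 2K.\<close>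
    have "\<bar>g e\<bar> < 2" if e: "e \<in> arcs G" for e
    proof -
      have "\<bar>K * g e\<bar> < K * 2"
        using g(1) e Suc.prems(1)[OF e] by (auto simp: rounding_def K_def)
      hence "K * \<bar>g e\<bar> < K * 2" by (simp add: abs_mult K_def)
      thus ?thesis by (subst (asm) mult_less_cancel_left_pos) (simp_all add: K_def)
    qed
    hence "restrict g (arcs G) \<in> k_flows G 2"
      using g(2) by (simp add: k_flows_iff cong: excess_cong)
    then obtain j where "j < N" "w j = restrict g (arcs G)"
      using w_bij unfolding bij_betw_def by (metis imageE lessThan_iff)
    thus ?thesis using g(1) by (auto simp: split_def rounding_def)
  qed
  define i where "i = (LEAST j. split j)"
  have i: "split i" "\<And>j. split j \<Longrightarrow> i \<le> j"
    unfolding i_def using \<open>\<exists>j. split j\<close> by (auto intro: LeastI_ex Least_le)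
  have iN: "i < N" using i(1) by (simp add: split_def)
  have near: "\<bar>f e - K * w i e\<bar> < K" if "e \<in> arcs G" for e
    using i(1) that by (simp add: split_def rounding_def)
  \<comment> \<open>By rounding, \<open>f e\<close> has the sign of \<open>w i e\<close> where that
    is nonzero and is below \<open>K\<close> in absolute value elsewhere, so the bound drops by
    one.\<close>
  have "\<bar>f e - w i e\<bar> \<le> int k" if "e \<in> arcs G" for e
    using w_cases[OF iN that] near[OF that] Suc.prems(1)[OF that] by (auto simp: K_def)
  moreover have "excess G (\<lambda>e. f e - w i e) x = 0" if "x \<in> verts G" for x
    using Suc.prems(2)[OF that] w_flow[OF iN] that by (simp add: excess_diff k_flows_iff)
  ultimately obtain u where u: "Poly_Mapping.keys u \<in> triangulation" "total_degree u = k"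
    "\<And>e. e \<in> arcs G \<Longrightarrow> val u e = f e - w i e"
    using Suc.IH[of "\<lambda>e. f e - w i e"] by blast
  have uN: "Poly_Mapping.keys u \<subseteq> {..<N}" "sign_compatible (Poly_Mapping.keys u)"
    using u(1) by (auto simp: triangulation_def)
  define u' where "u' = u + Poly_Mapping.single i 1"
  have k': "Poly_Mapping.keys u' = insert i (Poly_Mapping.keys u)"
    by (simp add: u'_def keys_add_exp)
  have d': "total_degree u' = Suc k"
    unfolding u'_def using total_degree_add_single[OF uN(1) iN] u(2) by simp
  have v': "val u' e = f e" if "e \<in> arcs G" for e
    unfolding u'_def using val_add_single[OF iN] u(3)[OF that] by simp
  have N': "Poly_Mapping.keys u' \<subseteq> {..<N}" using uN(1) iN by (simp add: k')
  \<comment> \<open>The remainder never has the sign opposite to \<open>w i e\<close>, hence neither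
    do its summands.\<close>
  have sc: "0 \<le> w i e * w j e" if j: "j \<in> Poly_Mapping.keys u" and e: "e \<in> arcs G" for j e
  proof -
    have "j < N" using j uN(1) by auto
    have "\<not> (0 < val u e \<and> w j e = -1)" "\<not> (val u e < 0 \<and> w j e = 1)"
      "w j e = 1 \<Longrightarrow> 0 < val u e" "w j e = -1 \<Longrightarrow> val u e < 0"
      using val_sign_iff[OF uN e] j by fastforce+
    thus ?thesis
      using near[OF e] u(3)[OF e] w_cases[OF iN e] w_cases[OF \<open>j < N\<close> e]
      by (smt (verit) mult_minus_right mult_cancel_left1 mult_cancel_right1 mult_minus_left)
  qed
  have sc': "sign_compatible (Poly_Mapping.keys u')"
    using sc uN(2) unfolding sign_compatible_def k' by (auto simp: mult.commute)
  have round: "rounding (arcs G) f K (w j) \<longleftrightarrow>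
      (\<forall>e \<in> arcs G. \<exists>l \<in> Poly_Mapping.keys u'. w j e = w l e)" if "j < N" for j
    using rounding_w_iff[OF N' sc' that] v' by (simp add: rounding_def d' K_def)
  \<comment> \<open>Each key agrees with itself on every arc, so it rounds \<open>f\<close> and
    cannot lie below the least choice.\<close>
  have le: "i \<le> l" if "l \<in> Poly_Mapping.keys u'" for l
    using that N' round[of l] by (intro i(2)) (auto simp: split_def)
  have "greedy (Poly_Mapping.keys u')"
    unfolding greedy_def
  proof (intro ballI allI impI)
    fix t j assume t: "t \<in> Poly_Mapping.keys u'" and j: "j < N"
      and *: "\<forall>e \<in> arcs G. \<exists>l \<in> Poly_Mapping.keys u'. t \<le> l \<and> w j e = w l e"
    show "t \<le> j"
    proof (cases "t = i")
      case True
      thus ?thesis using * round[OF j] j by (auto simp: split_def intro!: i(2))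
    next
      case False
      hence "t \<in> Poly_Mapping.keys u" "i < t" using t le[OF t] by (auto simp: k')
      \<comment> \<open>Indices from \<open>t\<close> on differ from \<open>i\<close>, so the
        witnesses are keys of \<open>u\<close>, whose greediness applies.\<close>
      moreover have "\<forall>e \<in> arcs G. \<exists>l \<in> Poly_Mapping.keys u. t \<le> l \<and> w j e = w l e"
        using * \<open>i < t\<close> unfolding k' by fastforce
      ultimately show ?thesis
        using u(1) j unfolding triangulation_def greedy_def by blast
    qed
  qed
  thus ?case
    using N' sc' d' v' by (intro exI[of _ u']) (simp add: triangulation_def)
qed

section \<open>Boundary faces and the count\<close>

lemma keys_boundary_iff:
  assumes "Poly_Mapping.keys u \<in> triangulation"
  shows "Poly_Mapping.keys u \<in> boundary \<longleftrightarrow>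
    (\<exists>e \<in> arcs G. val u e = 0 \<or> \<not> \<bar>val u e\<bar> < int (total_degree u))"
proof -
  have u: "Poly_Mapping.keys u \<subseteq> {..<N}" "sign_compatible (Poly_Mapping.keys u)"
    using assms by (auto simp: triangulation_def)
  have "val u e = 0 \<longleftrightarrow> (\<forall>i \<in> Poly_Mapping.keys u. w i e = 0)"
    and "\<not> \<bar>val u e\<bar> < int (total_degree u) \<longleftrightarrow> (\<forall>i \<in> Poly_Mapping.keys u. \<bar>w i e\<bar> = 1)"
    if e: "e \<in> arcs G" for e
  proof -
    have w: "w i e = -1 \<or> w i e = 0 \<or> w i e = 1" if "i \<in> Poly_Mapping.keys u" for i
      using w_cases[of i e] that u(1) e by blast
    have "val u e = 0 \<longleftrightarrow> \<not> 0 < val u e \<and> \<not> val u e < 0" by auto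
    thus "val u e = 0 \<longleftrightarrow> (\<forall>i \<in> Poly_Mapping.keys u. w i e = 0)"
      unfolding val_sign_iff[OF u e] using w by fastforce
    \<comment> \<open>The case \<open>x = 0\<close> of \<open>val_near_iff\<close>: the bound is
      attained exactly when 0 is not among the values.\<close>
    show "\<not> \<bar>val u e\<bar> < int (total_degree u) \<longleftrightarrow> (\<forall>i \<in> Poly_Mapping.keys u. \<bar>w i e\<bar> = 1)"
      using val_near_iff[OF u e, of 0] w by fastforce
  qed
  thus ?thesis using assms by (auto simp: boundary_def)
qed

text \<open>Summation is injective by \<open>val_inj\<close> and onto by
  \<open>exists_greedy_decomposition\<close>; leaving out \<open>boundary\<close> keeps the sums
  that are nowhere zero and strictly below \<open>k\<close> in absolute value.\<close>

lemma card_monomials: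
  "card {u. Poly_Mapping.keys u \<in> triangulation - boundary \<and> total_degree u = k} =
    integral_flow_polynomial G k" (is "card ?M = _")
proof -
  let ?F = "nowhere_zero_k_flows G k"
  have "bij_betw (\<lambda>u. restrict (val u) (arcs G)) ?M ?F"
    unfolding bij_betw_def
  proof (intro conjI equalityI subsetI)
    show "inj_on (\<lambda>u. restrict (val u) (arcs G)) ?M"
    proof (rule inj_onI)
      fix u u' assume *: "u \<in> ?M" "u' \<in> ?M" "restrict (val u) (arcs G) = restrict (val u') (arcs G)"
      show "u = u'"
        by (rule val_inj[where k = k]) (use * in \<open>auto dest: fun_cong split: if_splits simp: restrict_def\<close>)
    qed
  next
    fix f assume "f \<in> (\<lambda>u. restrict (val u) (arcs G)) ` ?M"
    then obtain u where u: "f = restrict (val u) (arcs G)" "Poly_Mapping.keys u \<in> triangulation"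
      "Poly_Mapping.keys u \<notin> boundary" "total_degree u = k" by blast
    have "excess G f x = 0" if "x \<in> verts G" for x
      using excess_val[OF that, of u] u(1) by (simp cong: excess_cong)
    thus "f \<in> ?F"
      using keys_boundary_iff[OF u(2)] u(3,4)
      by (auto simp: nowhere_zero_k_flows_def k_flows_iff u(1))
  next
    fix f assume "f \<in> ?F"
    hence f: "f \<in> extensional (arcs G)" "\<And>e. e \<in> arcs G \<Longrightarrow> f e \<noteq> 0 \<and> \<bar>f e\<bar> < int k"
      "\<And>x. x \<in> verts G \<Longrightarrow> excess G f x = 0"
      by (auto simp: nowhere_zero_k_flows_def k_flows_iff)
    obtain u where u: "Poly_Mapping.keys u \<in> triangulation" "total_degree u = k"
      "\<And>e. e \<in> arcs G \<Longrightarrow> val u e = f e"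
      using exists_greedy_decomposition[of f k] f by (metis less_imp_le)
    have "Poly_Mapping.keys u \<notin> boundary"
      using keys_boundary_iff[OF u(1)] u(2,3) f(2) by simp
    moreover have "f = restrict (val u) (arcs G)"
      using f(1) u(3) by (auto simp: restrict_def extensional_def)
    ultimately show "f \<in> (\<lambda>u. restrict (val u) (arcs G)) ` ?M"
      using u(1,2) by blast
  qed
  thus ?thesis
    unfolding integral_flow_polynomial_def by (rule bij_betw_same_card)
qed

end

theorem theorem7:
  fixes G :: "('a, 'b) pre_digraph"
  assumes "fin_digraph G"
  shows "\<exists>(V' :: nat set) \<Delta> \<Delta>'.
    finite V' \<and> abstract_simplicial_complex V' \<Delta> \<and> abstract_simplicial_complex V' \<Delta>' \<and>
    \<Delta>' \<subseteq> \<Delta> \<and>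
    (\<forall>k > 0. integral_flow_polynomial G k =
      hilbert_function V' \<Delta>
        (relative_SR_ideal V' \<Delta> \<Delta>' :: ((nat \<Rightarrow>\<^sub>0 nat) \<Rightarrow>\<^sub>0 'k::field) set set) k)"
proof -
  interpret fin_digraph G by (rule assms)
  \<comment> \<open>Any order of the 2-flows will do.\<close>
  obtain w where "bij_betw w {..<card (k_flows G 2)} (k_flows G 2)"
    using ex_bij_betw_nat_finite[OF finite_k_flows] unfolding atLeast0LessThan by blast
  then interpret flow_triangulation G "card (k_flows G 2)" w by unfold_locales
  have sub: "boundary \<subseteq> triangulation" by (auto simp: boundary_def)
  show ?thesis
    by (rule exI[of _ "{..<card (k_flows G 2)}"], rule exI[of _ triangulation],
        rule exI[of _ boundary])
       (simp add: complex_triangulation complex_boundary sub card_monomials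
         hilbert_function_relative_SR_ideal[OF complex_triangulation _ complex_boundary]
         del: Diff_iff)
qed

end
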